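(* Every singleton in the ERI space $X=(X_0,\tau_{\mathrm{ERI}})$ is closed; that is, $X$ is $T_1$.
   Context: Let $\overline{\mathbb{R}}=[-\infty,+\infty]$ be the extended real line with its order topology. Let $\sim$ be the equivalence relation on $\overline{\mathbb{R}}$ whose only non-singleton class is $\{-\infty,0,+\infty\}$, let $X_0=\overline{\mathbb{R}}/{\sim}$ be the quotient set, $q\colon\overline{\mathbb{R}}\to X_0$ the projection, and $\ast=q(-\infty)=q(0)=q(+\infty)$. The ERI topology $\tau_{\mathrm{ERI}}$ on $X_0$ consists of all $U\subseteq X_0$ such that (a) $q^{-1}(U)$ is open in $\overline{\mathbb{R}}$, and (b) if $\ast\in U$ then $q^{-1}(U)$ is dense in $\overline{\mathbb{R}}$. (This is a topology.) The ERI space is $X=(X_0,\tau_{\mathrm{ERI}})$. *)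

theory Defs
  imports "HOL-Analysis.Analysis"
begin

definition eri_rel :: "(ereal \<times> ereal) set" where
  "eri_rel = {(x, y). x = y \<or> (x \<in> {-\<infinity>, 0, \<infinity>} \<and> y \<in> {-\<infinity>, 0, \<infinity>})}"

lemma equiv_eri_rel: "equiv UNIV eri_rel"
  by (auto simp: equiv_def refl_on_def sym_def trans_def eri_rel_def)

definition eri_carrier :: "ereal set set" where
  "eri_carrier = UNIV // eri_rel"

definition eri_proj :: "ereal \<Rightarrow> ereal set" where
  "eri_proj x = eri_rel `` {x}"

definition eri_star :: "ereal set" where
  "eri_star = eri_proj 0"

lemma eri_star_alt: "eri_star = eri_proj (-\<infinity>)" "eri_star = eri_proj \<infinity>"
  by (auto simp: eri_star_def eri_proj_def eri_rel_def)

lemma eri_star_eq: "eri_star = {-\<infinity>, 0, \<infinity>}"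
  by (auto simp: eri_star_def eri_proj_def eri_rel_def)

lemma eri_carrier_eq: "eri_carrier = range eri_proj"
  by (auto simp: eri_carrier_def eri_proj_def quotient_def)

definition eri_open :: "ereal set set \<Rightarrow> bool" where
  "eri_open U \<longleftrightarrow> U \<subseteq> eri_carrier \<and> open (eri_proj -` U)
     \<and> (eri_star \<in> U \<longrightarrow> closure (eri_proj -` U) = UNIV)"

definition eri_space :: "ereal set topology" where
  "eri_space = topology eri_open"

lemma istopology_eri_open: "istopology eri_open"
  unfolding istopology_def
proof (intro conjI allI impI)
  fix S T assume S: "eri_open S" and T: "eri_open T"
  have "closure (eri_proj -` (S \<inter> T)) = UNIV" if "eri_star \<in> S \<inter> T"
  proof -
    have "eri_proj -` S \<subseteq> closure (eri_proj -` S \<inter> closure (eri_proj -` T))"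
      using that S T by (auto simp: eri_open_def)
    also have "\<dots> \<subseteq> closure (eri_proj -` S \<inter> eri_proj -` T)"
      using S open_Int_closure_subset[of "eri_proj -` S" "eri_proj -` T"]
      by (metis closure_closure closure_mono eri_open_def)
    finally have "closure (eri_proj -` S) \<subseteq> closure (eri_proj -` (S \<inter> T))"
      by (metis closed_closure closure_minimal vimage_Int)
    then show ?thesis using that S by (auto simp: eri_open_def)
  qed
  then show "eri_open (S \<inter> T)"
    using S T by (auto simp: eri_open_def vimage_Int)
next
  fix K assume K: "\<forall>S\<in>K. eri_open S"
  have "closure (eri_proj -` \<Union>K) = UNIV" if star: "eri_star \<in> \<Union>K"
  proof -
    obtain S where S: "S \<in> K" "eri_star \<in> S" using star by blast
    then have "closure (eri_proj -` S) \<subseteq> closure (eri_proj -` \<Union>K)"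
      by (intro closure_mono) auto
    then show ?thesis using S K by (auto simp: eri_open_def)
  qed
  moreover have "open (eri_proj -` \<Union>K)"
    using K by (auto simp: eri_open_def vimage_Union)
  moreover have "\<Union>K \<subseteq> eri_carrier"
    using K by (auto simp: eri_open_def)
  ultimately show "eri_open (\<Union>K)"
    by (simp add: eri_open_def)
qed

lemma openin_eri_space: "openin eri_space U \<longleftrightarrow> eri_open U"
  by (simp add: eri_space_def istopology_eri_open topology_inverse')

lemma topspace_eri_space: "topspace eri_space = eri_carrier"
proof -
  have "eri_proj -` eri_carrier = UNIV"
    by (auto simp: eri_carrier_eq)
  then have "eri_open eri_carrier"
    by (simp add: eri_open_def)
  then show ?thesis
    by (auto simp: topspace_def openin_eri_space eri_open_def)
qed

end

theory Submission imports Defs begin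

text \<open>A point of the quotient pulls back to one real or to
  \<open>{-\<infinity>, 0, \<infinity>}\<close>. By finiteness the complement of this fibre is open
  and dense, so the complement of the point meets both clauses of \<open>eri_open\<close>.\<close>

text \<open>Every fibre of the projection is finite, and the extended real line is a Hausdorff space
  without isolated points, so the complement of a fibre is open and dense.\<close>

lemma interior_finite_eq_empty:
  fixes S :: "'a::{t1_space, perfect_space} set"
  assumes "finite S"
  shows "interior S = {}"
proof (rule ccontr)
  assume "interior S \<noteq> {}"
  then obtain x where x: "x \<in> interior S"
    by blast
  have "finite (interior S)"
    using assms interior_subset by (rule rev_finite_subset)
  \<comment> \<open>Removing the other finitely many points, a closed set, would leave
    \<open>x\<close> isolated.\<close>
  then have "open (interior S - (interior S - {x}))"
    by (intro open_Diff open_interior finite_imp_closed) simp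
  moreover have "interior S - (interior S - {x}) = {x}"
    using x by blast
  ultimately show False
    by (simp add: not_open_singleton)
qed

lemma finite_vimage_eri_proj_singleton:
  assumes "x \<in> eri_carrier"
  shows "finite (eri_proj -` {x})"
proof -
  obtain a where a: "x = eri_proj a"
    using assms by (auto simp: eri_carrier_eq)
  \<comment> \<open>This bound covers singleton classes and \<open>eri_star\<close> alike.\<close>
  have "eri_proj -` {x} \<subseteq> {a, -\<infinity>, 0, \<infinity>}"
    by (auto simp: a eri_proj_def eri_rel_def)
  then show ?thesis
    by (rule finite_subset) simp
qed

lemma closedin_eri_space_singleton:
  assumes "x \<in> eri_carrier"
  shows "closedin eri_space {x}"
proof -
  have fin: "finite (eri_proj -` {x})"
    using assms by (rule finite_vimage_eri_proj_singleton)
  have vim: "eri_proj -` (eri_carrier - {x}) = - (eri_proj -` {x})"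
    by (auto simp: eri_carrier_eq)
  have "open (- (eri_proj -` {x}))"
    using fin by (simp add: finite_imp_closed open_Compl)
  \<comment> \<open>Density holds for every \<open>x\<close>, so no case split on
    \<open>x = eri_star\<close> arises.\<close>
  moreover have "closure (- (eri_proj -` {x})) = UNIV"
    using fin by (simp add: closure_complement interior_finite_eq_empty)
  ultimately have "eri_open (eri_carrier - {x})"
    by (simp add: eri_open_def vim)
  then show ?thesis
    using assms by (simp add: closedin_def topspace_eri_space openin_eri_space)
qed

theorem proposition2p12:
  "(\<forall>x \<in> eri_carrier. closedin eri_space {x}) \<and> t1_space eri_space"
  by (simp add: t1_space_closedin_singleton topspace_eri_space closedin_eri_space_singleton)

end
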